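(* Let $z\in\mathbb{C}$ and $\tau\in\mathbb{C}$ with $|\arg(\tau)|<\pi$. For $N\in\mathbb{N}$ define $$G_N(z;\tau):=\frac{1}{\tau\,\Gamma(z)}\exp\Big(\tilde a(\tau)\frac{z}{\tau}+\tilde b(\tau)\frac{z^2}{2\tau^2}\Big)\prod_{m=1}^N\frac{\Gamma(m\tau)}{\Gamma(z+m\tau)}\,e^{z\psi(m\tau)+\frac{z^2}{2}\psi'(m\tau)},$$ where $\tilde a(\tau)=a(\tau)-\gamma\tau$ and $\tilde b(\tau)=b(\tau)+\frac{\pi^2\tau^2}{6}$. Then for every $M=1,2,3,\dots$, $$G(z;\tau)=G_N(z;\tau)\exp\Big(z^3\sum_{k=1}^M\frac{(-\tau)^{-k-1}P_k(z;-\tau)}{k(k+1)(k+2)}N^{-k}+O(N^{-M-1})\Big)\qquad\text{as }N\to+\infty.$$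
   Context: $\psi=\Gamma'/\Gamma$ is the digamma function, $\gamma=-\psi(1)$ the Euler–Mascheroni constant, $\ln\Gamma$ the standard log-gamma function on $\mathbb{C}\setminus(-\infty,0]$ and $\ln$ the principal logarithm. For $\tau\in\mathbb{C}\setminus(-\infty,0]$ define the gamma modular forms $$C(\tau):=\lim_{m\to\infty}\Big[\sum_{k=1}^{m-1}\psi(k\tau)+\tfrac12\psi(m\tau)-\tfrac1\tau\ln\Big(\tfrac{\Gamma(m\tau)}{\sqrt{2\pi}}\Big)-\tfrac{\tau}{12}\psi'(m\tau)\Big],$$ $$D(\tau):=\lim_{m\to\infty}\Big[\sum_{k=1}^{m-1}\psi'(k\tau)+\tfrac12\psi'(m\tau)-\tfrac1\tau\psi(m\tau)-\tfrac{\tau}{12}\psi''(m\tau)\Big],$$ and $a(\tau):=-\gamma\tau+\frac\tau2\ln(2\pi\tau)+\frac12\ln\tau-\tau C(\tau)$, $b(\tau):=-\frac{\pi^2\tau^2}{6}-\tau\ln\tau-\tau^2D(\tau)$. The Barnes double gamma function is the entire function of $z$ $$G(z;\tau):=\frac z\tau e^{a(\tau)\frac z\tau+b(\tau)\frac{z^2}{2\tau}}\prod_{m\ge0}\prod_{n\ge0}{}'\Big(1+\frac{z}{m\tau+n}\Big)e^{-\frac{z}{m\tau+n}+\frac{z^2}{2(m\tau+n)^2}},$$ where the prime means the term $m=n=0$ is omitted; it satisfies $G(1;\tau)=1$, $G(z+1;\tau)=\Gamma(z/\tau)G(z;\tau)$ and $G(z+\tau;\tau)=(2\pi)^{\frac{\tau-1}{2}}\tau^{-z+\frac12}\Gamma(z)G(z;\tau)$.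 With $B_n$ the Bernoulli numbers ($\frac{u}{e^u-1}=\sum_{n\ge0}B_n\frac{u^n}{n!}$), let $q_n(\tau)=\sum_{k=0}^n\binom nkB_kB_{n-k}\tau^k$ and $P_n(z;\tau)=\sum_{k=1}^n\binom{n+2}{k+2}q_{n-k}(\tau)z^{k-1}$ for $n\ge1$.
   Formalization: In the definition of G(z;τ) the exponent b(τ)z²/(2τ) is corrected to b(τ)z²/(2τ²); with the printed exponent G/G_N tends to exp(b(τ)z²(τ−1)/(2τ²)), which is not 1 in general, so the claim would fail. *)

theory Defs
  imports
    "HOL-Analysis.Analysis"
    "HOL-Computational_Algebra.Formal_Power_Series"
    "HOL-Library.Landau_Symbols"
begin

text \<open>
  The logarithm of \<open>Gamma (m \<tau>) / sqrt (2 \<pi>)\<close> is taken along the standard branch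
  \<open>ln_Gamma\<close>, holomorphic off the negative real axis. The principal logarithm of the quotient
  would jump as \<open>m\<close> grows and the limit would not exist for non-real \<open>\<tau>\<close>.
\<close>

definition gamma_modular_C :: "complex \<Rightarrow> complex" where
  "gamma_modular_C \<tau> = lim (\<lambda>m::nat.
     (\<Sum>k=1..<m. Digamma (of_nat k * \<tau>)) + 1 / 2 * Digamma (of_nat m * \<tau>)
     - 1 / \<tau> * (ln_Gamma (of_nat m * \<tau>) - of_real (ln (sqrt (2 * pi))))
     - \<tau> / 12 * Polygamma 1 (of_nat m * \<tau>))"

definition gamma_modular_D :: "complex \<Rightarrow> complex" where
  "gamma_modular_D \<tau> = lim (\<lambda>m::nat.
     (\<Sum>k=1..<m. Polygamma 1 (of_nat k * \<tau>)) + 1 / 2 * Polygamma 1 (of_nat m * \<tau>)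
     - 1 / \<tau> * Digamma (of_nat m * \<tau>)
     - \<tau> / 12 * Polygamma 2 (of_nat m * \<tau>))"

text \<open>
  The term \<open>- euler_mascheroni * \<tau>\<close> in \<open>barnes_a\<close> follows the source. The normalisation
  \<open>G(1; \<tau>) = 1\<close> requires \<open>+ euler_mascheroni * \<tau>\<close> instead; for instance
  \<open>gamma_modular_C 1 = 1/2\<close>, while the Weierstrass product of the Barnes G-function gives
  \<open>\<gamma> + ln (2 \<pi>) / 2 - 1/2\<close> for \<open>a\<close> at \<open>\<tau> = 1\<close>. The change multiplies both
  \<open>double_Gamma z \<tau>\<close> and \<open>double_Gamma_approx N z \<tau>\<close> by \<open>exp (2 * \<gamma> * z)\<close>, so relations
  between the two do not depend on the sign.
\<close>

definition barnes_a :: "complex \<Rightarrow> complex" where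
  "barnes_a \<tau> = - euler_mascheroni * \<tau> + \<tau> / 2 * ln (2 * of_real pi * \<tau>) + 1 / 2 * ln \<tau>
     - \<tau> * gamma_modular_C \<tau>"

definition barnes_b :: "complex \<Rightarrow> complex" where
  "barnes_b \<tau> = - (of_real pi ^ 2 * \<tau> ^ 2 / 6) - \<tau> * ln \<tau> - \<tau> ^ 2 * gamma_modular_D \<tau>"

text \<open>
  The quadratic term of the exponent has denominator \<open>2 * \<tau>\<^sup>2\<close>, where the source prints
  \<open>2 * \<tau>\<close>. With \<open>2 * \<tau>\<close> the function does not in general satisfy
  \<open>G(z + 1; \<tau>) = \<Gamma>(z / \<tau>) G(z; \<tau>)\<close>, even up to a constant factor, and
  \<open>double_Gamma_approx N z \<tau>\<close> does not converge to it: the factors with \<open>m = 0\<close> multiply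
  to \<open>exp (- \<gamma> * z + \<pi>\<^sup>2 * z\<^sup>2 / 12) / (z * \<Gamma>(z))\<close>, which turns \<open>b\<close> into
  \<open>b + \<pi>\<^sup>2 * \<tau>\<^sup>2 / 6\<close> exactly for the denominator \<open>2 * \<tau>\<^sup>2\<close>.
\<close>

definition double_Gamma :: "complex \<Rightarrow> complex \<Rightarrow> complex" where
  "double_Gamma z \<tau> =
     z / \<tau> * exp (barnes_a \<tau> * (z / \<tau>) + barnes_b \<tau> * (z ^ 2 / (2 * \<tau> ^ 2))) *
     (\<Prod>m. \<Prod>n. if m = 0 \<and> n = 0 then 1
        else (1 + z / (of_nat m * \<tau> + of_nat n)) *
             exp (- (z / (of_nat m * \<tau> + of_nat n)) +
                  z ^ 2 / (2 * (of_nat m * \<tau> + of_nat n) ^ 2)))"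

definition bernoulli_number :: "nat \<Rightarrow> complex" where
  "bernoulli_number n = fact n * fps_nth (fps_X / (fps_exp 1 - 1)) n"

definition barnes_q :: "nat \<Rightarrow> complex \<Rightarrow> complex" where
  "barnes_q n \<tau> =
     (\<Sum>k=0..n. of_nat (n choose k) * bernoulli_number k * bernoulli_number (n - k) * \<tau> ^ k)"

definition barnes_P :: "nat \<Rightarrow> complex \<Rightarrow> complex \<Rightarrow> complex" where
  "barnes_P n z \<tau> =
     (\<Sum>k=1..n. of_nat ((n + 2) choose (k + 2)) * barnes_q (n - k) \<tau> * z ^ (k - 1))"

definition barnes_a_tilde :: "complex \<Rightarrow> complex" where
  "barnes_a_tilde \<tau> = barnes_a \<tau> - euler_mascheroni * \<tau>"

definition barnes_b_tilde :: "complex \<Rightarrow> complex" where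
  "barnes_b_tilde \<tau> = barnes_b \<tau> + of_real pi ^ 2 * \<tau> ^ 2 / 6"

text \<open>Reciprocals of \<open>\<Gamma>\<close> are the entire function \<open>rGamma\<close>, with value 0 at the poles of \<open>\<Gamma>\<close>.\<close>

definition double_Gamma_approx :: "nat \<Rightarrow> complex \<Rightarrow> complex \<Rightarrow> complex" where
  "double_Gamma_approx N z \<tau> =
     1 / \<tau> * rGamma z *
     exp (barnes_a_tilde \<tau> * (z / \<tau>) + barnes_b_tilde \<tau> * (z ^ 2 / (2 * \<tau> ^ 2))) *
     (\<Prod>m=1..N. Gamma (of_nat m * \<tau>) * rGamma (z + of_nat m * \<tau>) *
        exp (z * Digamma (of_nat m * \<tau>) + z ^ 2 / 2 * Polygamma 1 (of_nat m * \<tau>)))"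

end

theory Submission
  imports Defs
begin

text \<open>
  The products over \<open>n\<close> are evaluated by Euler's limit for \<open>\<Gamma>\<close>, so that \<open>G / G\<^sub>N\<close> is the product of
  the Weierstrass factors over all lattice points \<open>w = m * \<tau> + n\<close> with \<open>m > N\<close>. Let \<open>g w\<close> be the
  logarithm \<open>Ln (1 + z / w) - z / w + z\<^sup>2 / (2 * w\<^sup>2)\<close> of such a factor, and \<open>S x\<close> the claimed exponent as
  a polynomial in \<open>1 / x\<close>, \<open>x = N * \<tau>\<close>. With \<open>T w = S (w - \<tau>) - S w\<close>, the sum of \<open>T w - T (w + 1)\<close>
  over the same lattice points telescopes in both directions to \<open>S (N * \<tau>)\<close>. It therefore suffices
  that \<open>g w - (T w - T (w + 1)) = O(\<bar>w\<bar> ^ (- M - 3))\<close>. This is an identity between the Taylor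
  coefficients in \<open>h = 1 / w\<close>; under the Borel transform translations of \<open>w\<close> become exponential
  factors, and the identity reduces to the generating function of the Bernoulli numbers.
\<close>

unbundle no vec_syntax
unbundle fps_syntax

section \<open>The Borel transform of the exponent\<close>

definition barnes_log :: "complex \<Rightarrow> complex \<Rightarrow> complex" where
  "barnes_log z w = Ln (1 + z / w) - z / w + z ^ 2 / (2 * w ^ 2)"

definition tail_coeff :: "complex \<Rightarrow> complex \<Rightarrow> nat \<Rightarrow> complex" where
  "tail_coeff z \<tau> k = z ^ 3 * (-1) ^ (k + 1) * barnes_P k z (- \<tau>) /
     (\<tau> * (of_nat k * (of_nat k + 1) * (of_nat k + 2)))"

text \<open>
  \<open>tail_sum M z \<tau> (N * \<tau>)\<close> is the exponent of the theorem, rewritten in powers of \<open>1 / (N * \<tau>)\<close>.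
\<close>

definition tail_sum :: "nat \<Rightarrow> complex \<Rightarrow> complex \<Rightarrow> complex \<Rightarrow> complex" where
  "tail_sum M z \<tau> x = (\<Sum>k=1..M. tail_coeff z \<tau> k / x ^ k)"

definition tail_diff :: "nat \<Rightarrow> complex \<Rightarrow> complex \<Rightarrow> complex \<Rightarrow> complex" where
  "tail_diff M z \<tau> w = tail_sum M z \<tau> (w - \<tau>) - tail_sum M z \<tau> w"

definition tail_remainder :: "nat \<Rightarrow> complex \<Rightarrow> complex \<Rightarrow> complex \<Rightarrow> complex" where
  "tail_remainder M z \<tau> w = barnes_log z w - (tail_diff M z \<tau> w - tail_diff M z \<tau> (w + 1))"

section \<open>Generating functions of the Bernoulli numbers and of \<open>barnes_q\<close>\<close>

abbreviation (input) bernoulli_fps :: "complex fps" where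
  "bernoulli_fps \<equiv> fps_X / (fps_exp 1 - 1)"

text \<open>Division of formal power series is exact only if the divisor has no larger subdegree;
  the linear coefficient 1 of \<open>fps_exp 1 - 1\<close> ensures this.\<close>

lemma bernoulli_fps_mult: "bernoulli_fps * (fps_exp 1 - 1) = fps_X"
proof -
  have nz: "fps_exp (1::complex) - 1 \<noteq> 0"
  proof
    assume "fps_exp (1::complex) - 1 = 0"
    then have "(fps_exp (1::complex) - 1) $ 1 = 0" by simp
    then show False by simp
  qed
  have "subdegree (fps_exp (1::complex) - 1) \<le> 1"
    by (rule subdegree_leI) simp
  then have "(fps_exp (1::complex) - 1) dvd fps_X"
    using nz by (subst fps_dvd_iff) auto
  then show ?thesis by (rule dvd_div_mult_self)
qed

lemma bernoulli_fps_scaled_mult: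
  "(bernoulli_fps oo (fps_const c * fps_X)) * (fps_exp c - 1) = fps_const c * fps_X"
proof -
  have "(bernoulli_fps * (fps_exp 1 - 1)) oo (fps_const c * fps_X) = fps_X oo (fps_const c * fps_X)"
    by (simp only: bernoulli_fps_mult)
  then show ?thesis
    by (simp add: fps_compose_mult_distrib fps_compose_sub_distrib fps_exp_compose_linear)
qed

lemma bernoulli_fps_nth: "bernoulli_fps $ n = bernoulli_number n / fact n"
  by (simp add: bernoulli_number_def)

text \<open>With \<open>B\<close> the Bernoulli generating function, the Cauchy product
  \<open>B(u) * B(- \<tau> * u)\<close> generates \<open>barnes_q n (- \<tau>) / fact n\<close>;
  replacing \<open>u\<close> by \<open>- u\<close> produces the sign.\<close>

lemma barnes_q_eq_fps_nth:
  "((bernoulli_fps oo (fps_const (-1) * fps_X)) * (bernoulli_fps oo (fps_const \<tau> * fps_X))) $ n =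
     (-1) ^ n * barnes_q n (- \<tau>) / fact n"
proof -
  have "((bernoulli_fps oo (fps_const \<tau> * fps_X)) * (bernoulli_fps oo (fps_const (-1) * fps_X))) $ n =
     (\<Sum>k=0..n. (\<tau> ^ k * (bernoulli_number k / fact k)) *
                 ((-1) ^ (n - k) * (bernoulli_number (n - k) / fact (n - k))))"
    unfolding fps_mult_nth fps_compose_linear fps_nth_Abs_fps bernoulli_fps_nth ..
  also have "\<dots> = (\<Sum>k=0..n. (-1) ^ n * (of_nat (n choose k) * bernoulli_number k *
      bernoulli_number (n - k) * (- \<tau>) ^ k) / fact n)"
  proof (rule sum.cong)
    fix k assume "k \<in> {0..n}"
    then have k: "k \<le> n" by simp
    have "(-1) ^ n * (- \<tau>) ^ k = (-1) ^ (n - k) * \<tau> ^ k"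
    proof -
      have "(-1::complex) ^ n = (-1) ^ (n - k) * (-1) ^ k"
        using k by (simp flip: power_add)
      then show ?thesis
        by (simp add: power_minus[of \<tau>] mult.assoc)
    qed
    moreover have "of_nat (n choose k) = (fact n / (fact k * fact (n - k)) :: complex)"
      using k by (rule binomial_fact)
    ultimately show "(\<tau> ^ k * (bernoulli_number k / fact k)) *
                 ((-1) ^ (n - k) * (bernoulli_number (n - k) / fact (n - k))) =
        (-1) ^ n * (of_nat (n choose k) * bernoulli_number k *
          bernoulli_number (n - k) * (- \<tau>) ^ k) / fact n"
      by (simp add: divide_simps) (simp add: mult_ac)
  qed simp
  also have "\<dots> = (-1) ^ n * barnes_q n (- \<tau>) / fact n"
    by (simp add: barnes_q_def sum_distrib_left sum_divide_distrib)
  finally show ?thesis by (simp only: mult.commute)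
qed

text \<open>
  \<open>tail_borel z \<tau>\<close> is the Borel transform of the full series \<open>\<Sum>k. tail_coeff z \<tau> k * h ^ k\<close>, namely
  \<open>(1 - exp (- z * u) - z * u + z\<^sup>2 * u\<^sup>2 / 2) / (u * (1 - exp (- u)) * (exp (\<tau> * u) - 1))\<close>.
\<close>

definition tail_borel :: "complex \<Rightarrow> complex \<Rightarrow> complex fps" where
  "tail_borel z \<tau> = Abs_fps (\<lambda>n. tail_coeff z \<tau> (Suc n) / fact n)"

text \<open>This is \<open>exp (- z * u)\<close> without its terms of degree below 3, the negative
  of the numerator in the closed form of \<open>tail_borel\<close>.\<close>

definition exp_tail3 :: "complex \<Rightarrow> complex fps" where
  "exp_tail3 z = Abs_fps (\<lambda>n. if n \<ge> 3 then (- z) ^ n / fact n else 0)"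

text \<open>Up to sign and factorials, \<open>barnes_P\<close> is a convolution of
  \<open>barnes_q\<close> with an exponential series; its shifted indices reflect the missing
  degrees of \<open>exp_tail3\<close> and the extracted factor \<open>z ^ 3\<close>.\<close>

lemma exp_tail3_mult_nth:
  "(exp_tail3 z * ((bernoulli_fps oo (fps_const (-1) * fps_X)) *
      (bernoulli_fps oo (fps_const \<tau> * fps_X)))) $ (k + 2) =
     (-1) ^ k * z ^ 3 * barnes_P k z (- \<tau>) / fact (k + 2)"
proof -
  have "(exp_tail3 z * ((bernoulli_fps oo (fps_const (-1) * fps_X)) *
      (bernoulli_fps oo (fps_const \<tau> * fps_X)))) $ (k + 2) =
    (\<Sum>l=0..k+2. exp_tail3 z $ l * ((-1) ^ (k+2-l) * barnes_q (k+2-l) (- \<tau>) / fact (k+2-l)))"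
    by (simp only: fps_mult_nth[of "exp_tail3 z"] barnes_q_eq_fps_nth)
  also have "\<dots> = (\<Sum>l=1+2..k+2. exp_tail3 z $ l *
      ((-1) ^ (k+2-l) * barnes_q (k+2-l) (- \<tau>) / fact (k+2-l)))"
    by (rule sum.mono_neutral_right) (auto simp: exp_tail3_def)
  also have "\<dots> = (\<Sum>l=1..k. exp_tail3 z $ (l+2) *
      ((-1) ^ (k-l) * barnes_q (k-l) (- \<tau>) / fact (k-l)))"
    by (subst sum.shift_bounds_cl_nat_ivl) simp
  also have "\<dots> = (\<Sum>l=1..k. (-1) ^ k * z ^ 3 * (of_nat ((k + 2) choose (l + 2)) *
      barnes_q (k - l) (- \<tau>) * z ^ (l - 1)) / fact (k + 2))"
  proof (rule sum.cong)
    fix l assume "l \<in> {1..k}"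
    then have l: "1 \<le> l" "l \<le> k" by auto
    have "of_nat ((k + 2) choose (l + 2)) = (fact (k + 2) / (fact (l + 2) * fact (k + 2 - (l + 2))) :: complex)"
      using l by (intro binomial_fact) simp
    moreover have "(- z) ^ (l + 2) = (-1) ^ l * (z ^ 3 * z ^ (l - 1))"
    proof -
      have "l + 2 = 3 + (l - 1)" using l by simp
      then have "z ^ (l + 2) = z ^ 3 * z ^ (l - 1)" by (metis power_add)
      then show ?thesis by (simp add: power_minus[of z])
    qed
    moreover have "(-1::complex) ^ l * (-1) ^ (k - l) = (-1) ^ k"
      using l by (simp flip: power_add)
    ultimately show "exp_tail3 z $ (l+2) * ((-1) ^ (k-l) * barnes_q (k-l) (- \<tau>) / fact (k-l)) =
      (-1) ^ k * z ^ 3 * (of_nat ((k + 2) choose (l + 2)) *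
        barnes_q (k - l) (- \<tau>) * z ^ (l - 1)) / fact (k + 2)"
      using l by (simp add: exp_tail3_def del: fact_Suc)
  qed simp
  also have "\<dots> = (-1) ^ k * z ^ 3 * barnes_P k z (- \<tau>) / fact (k + 2)"
    by (simp only: barnes_P_def sum_distrib_left sum_divide_distrib)
  finally show ?thesis .
qed

lemma exp_tail3_eq_tail_borel:
  assumes "\<tau> \<noteq> 0"
  shows "exp_tail3 z * ((bernoulli_fps oo (fps_const (-1) * fps_X)) *
           (bernoulli_fps oo (fps_const \<tau> * fps_X))) =
         fps_const (- \<tau>) * (fps_X ^ 3 * tail_borel z \<tau>)" (is "?L = ?R")
proof (rule fps_ext)
  fix n
  show "?L $ n = ?R $ n"
  proof (cases "n < 3")
    case True
    have "?L $ n = 0"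
      unfolding fps_mult_nth[of "exp_tail3 z"] using True
      by (intro sum.neutral) (auto simp: exp_tail3_def)
    moreover have "?R $ n = 0" using True by (simp only: fps_mult_left_const_nth fps_X_power_mult_nth) simp
    ultimately show ?thesis by simp
  next
    case False
    define i where "i = n - 3"
    have n: "n = Suc i + 2" using False by (simp add: i_def)
    \<comment> \<open>The denominator \<open>k * (k + 1) * (k + 2)\<close> of
      \<open>tail_coeff\<close> at \<open>k = Suc i\<close> is \<open>fact (k + 2) / fact i\<close>,
      and the Borel transform supplies \<open>fact i\<close>.\<close>
    have "fact (Suc i + 2) = (of_nat (Suc i) * (of_nat (Suc i) + 1) * (of_nat (Suc i) + 2) * fact i :: complex)"
      by (simp add: algebra_simps)
    moreover have "of_nat (Suc i) + 1 \<noteq> (0::complex)" "of_nat (Suc i) + 2 \<noteq> (0::complex)"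
      by (metis of_nat_Suc of_nat_eq_0_iff nat.distinct(1) add.commute)
         (metis of_nat_add of_nat_numeral of_nat_eq_0_iff add_is_0 nat.distinct(1))
    ultimately have "- \<tau> * (tail_coeff z \<tau> (Suc i) / fact i) =
        (-1) ^ Suc i * z ^ 3 * barnes_P (Suc i) z (- \<tau>) / fact (Suc i + 2)"
      using assms unfolding tail_coeff_def
      by (simp add: divide_simps del: of_nat_Suc fact_Suc)
    moreover have "?R $ n = - \<tau> * (tail_coeff z \<tau> (Suc i) / fact i)"
      by (simp add: fps_X_power_mult_nth n tail_borel_def del: of_nat_Suc fact_Suc)
    ultimately show ?thesis by (simp only: n exp_tail3_mult_nth)
  qed
qed

text \<open>Closed form of \<open>tail_borel\<close>, cleared of denominators: the two Bernoulli
  factors of the preceding identity cancel against the exponential factors, and a common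
  \<open>- \<tau> * u ^ 2\<close> drops out.\<close>

lemma tail_borel_mult:
  assumes "\<tau> \<noteq> 0"
  shows "fps_X * ((fps_exp \<tau> - 1) * (1 - fps_exp (-1)) * tail_borel z \<tau>) = - exp_tail3 z"
proof -
  define Bm where "Bm = (bernoulli_fps oo (fps_const (-1) * fps_X))"
  define Bt where "Bt = (bernoulli_fps oo (fps_const \<tau> * fps_X))"
  have "Bm * (fps_exp (-1) - 1) = fps_const (-1) * fps_X"
    unfolding Bm_def by (rule bernoulli_fps_scaled_mult)
  then have m: "Bm * (1 - fps_exp (-1)) = fps_X"
    using minus_mult_right[of Bm "fps_exp (-1) - 1"] by (simp flip: fps_const_neg)
  have t: "Bt * (fps_exp \<tau> - 1) = fps_const \<tau> * fps_X"
    unfolding Bt_def by (rule bernoulli_fps_scaled_mult)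
  have "fps_const (- \<tau>) * (fps_X ^ 3 * tail_borel z \<tau>) * ((fps_exp \<tau> - 1) * (1 - fps_exp (-1))) =
        exp_tail3 z * (Bm * (1 - fps_exp (-1))) * (Bt * (fps_exp \<tau> - 1))"
    unfolding exp_tail3_eq_tail_borel[OF assms, symmetric] Bm_def Bt_def by (simp only: mult_ac)
  also have "\<dots> = exp_tail3 z * (fps_const \<tau> * fps_X ^ 2)"
    by (simp only: m t) (simp add: power2_eq_square mult_ac)
  finally have "(fps_const (- \<tau>) * fps_X ^ 2) *
        (fps_X * ((fps_exp \<tau> - 1) * (1 - fps_exp (-1)) * tail_borel z \<tau>)) =
      (fps_const (- \<tau>) * fps_X ^ 2) * (- exp_tail3 z)"
    by (simp add: power2_eq_square power3_eq_cube mult_ac flip: fps_const_neg)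
  moreover have "fps_const (- \<tau>) * fps_X ^ 2 \<noteq> (0 :: complex fps)"
    using assms by (simp del: fps_const_neg)
  ultimately show ?thesis by (simp only: mult_cancel_left) simp
qed

section \<open>The double difference of the exponent\<close>

text \<open>Expansion of \<open>1 / (w + a) ^ k\<close> in \<open>h = 1 / w\<close>.\<close>

definition shift_fps :: "complex \<Rightarrow> nat \<Rightarrow> complex fps" where
  "shift_fps a k = fps_X ^ k * inverse ((1 - fps_const (- a) * fps_X) ^ k)"

lemma has_fps_expansion_shift_fps:
  "(\<lambda>h. (h / (1 + a * h)) ^ k) has_fps_expansion shift_fps a k"
proof -
  have "(\<lambda>h. 1 - (- a) * h) has_fps_expansion (1 - fps_const (- a) * fps_X)"
    by (intro fps_expansion_intros)
  then have "(\<lambda>h. \<Prod>i<k. 1 - (- a) * h) has_fps_expansion (\<Prod>i<k. 1 - fps_const (- a) * fps_X)"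
    by (rule has_fps_expansion_prod)
  then have "(\<lambda>h. (1 - (- a) * h) ^ k) has_fps_expansion (1 - fps_const (- a) * fps_X) ^ k"
    by (simp del: fps_const_neg)
  then have "(\<lambda>h. h ^ k * inverse ((1 - (- a) * h) ^ k)) has_fps_expansion shift_fps a k"
    unfolding shift_fps_def
    by (intro has_fps_expansion_mult has_fps_expansion_fps_X_power has_fps_expansion_inverse)
       (simp_all add: fps_power_zeroth)
  then show ?thesis by (simp add: power_mult_distrib power_inverse field_class.field_divide_inverse)
qed

lemma shift_fps_nth_0: "k > 0 \<Longrightarrow> shift_fps a k $ 0 = 0"
  by (simp add: shift_fps_def)

text \<open>Negative binomial series. The binomial coefficient is split into factorials because, up
  to \<open>fact i\<close>, the result is the coefficient of \<open>u ^ i\<close> in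
  \<open>exp (- a * u) * u ^ n / n!\<close>.\<close>

lemma shift_fps_nth_Suc:
  "shift_fps a (Suc n) $ Suc i =
     (if n \<le> i then fact i * ((- a) ^ (i - n) / (fact n * fact (i - n))) else 0)"
proof (cases "n \<le> i")
  case True
  have "shift_fps a (Suc n) $ Suc i = of_nat ((Suc n + (i - n) - 1) choose (i - n)) * (- a) ^ (i - n)"
    unfolding shift_fps_def
    by (subst one_minus_const_fps_X_neg_power') (use True in \<open>simp_all only: fps_X_power_mult_nth, simp_all\<close>)
  also have "Suc n + (i - n) - 1 = i" using True by simp
  also have "of_nat (i choose (i - n)) = (fact i / (fact (i - n) * fact (i - (i - n))) :: complex)"
    by (rule binomial_fact) simp
  also have "i - (i - n) = n" using True by simp
  finally show ?thesis using True by (simp add: mult_ac)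
next
  case False
  then show ?thesis unfolding shift_fps_def by (simp only: fps_X_power_mult_nth) simp
qed

text \<open>
  In terms of the Borel transform, which sends \<open>h ^ (n + 1)\<close> to \<open>u ^ n / n!\<close>, the translation
  \<open>1 / h \<mapsto> 1 / h + a\<close> becomes multiplication by \<open>exp (- a * u)\<close>.
\<close>

lemma sum_shift_fps_nth_Suc:
  "(\<Sum>k=1..M. s k * shift_fps a k $ Suc i) =
     fact i * (fps_exp (- a) * Abs_fps (\<lambda>n. if n < M then s (Suc n) / fact n else 0)) $ i"
proof -
  have "(\<Sum>k=1..M. s k * shift_fps a k $ Suc i) = (\<Sum>n<M. s (Suc n) * shift_fps a (Suc n) $ Suc i)"
    by (rule sum.reindex_bij_witness[of _ Suc "\<lambda>k. k - 1"]) auto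
  also have "\<dots> = (\<Sum>n\<in>{..<M} \<inter> {0..i}. s (Suc n) * (fact i * ((- a) ^ (i - n) / (fact n * fact (i - n)))))"
    by (rule sum.mono_neutral_cong_right) (auto simp: shift_fps_nth_Suc)
  also have "\<dots> = (\<Sum>n=0..i. fact i * ((if n < M then s (Suc n) / fact n else 0) * ((- a) ^ (i - n) / fact (i - n))))"
    by (rule sum.mono_neutral_cong_left) auto
  also have "\<dots> = fact i * (Abs_fps (\<lambda>n. if n < M then s (Suc n) / fact n else 0) * fps_exp (- a)) $ i"
    by (simp add: fps_mult_nth sum_distrib_left)
  finally show ?thesis by (simp only: mult.commute)
qed

section \<open>Taylor series of the remainder at infinity\<close>

definition log_fps :: "complex \<Rightarrow> complex fps" where
  "log_fps z = Abs_fps (\<lambda>n. if n < 3 then 0 else - ((- z) ^ n) / of_nat n)"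

lemma has_fps_expansion_log_fps:
  "(\<lambda>h. Ln (1 + z * h) - z * h + z ^ 2 * h ^ 2 / 2) has_fps_expansion log_fps z"
proof (rule has_fps_expansionI)
  have "continuous_on UNIV (\<lambda>h. cmod (z * h))" by (intro continuous_intros)
  then have "((\<lambda>h. cmod (z * h)) \<longlongrightarrow> cmod (z * 0)) (nhds 0)"
    using continuous_on_eq_continuous_at tendsto_at_iff_tendsto_nhds
    by (metis UNIV_I isCont_def open_UNIV)
  then have "\<forall>\<^sub>F h in nhds 0. cmod (z * h) < 1"
    by (rule order_tendstoD) simp
  then show "\<forall>\<^sub>F u in nhds 0. (\<lambda>n. log_fps z $ n * u ^ n) sums (Ln (1 + z * u) - z * u + z\<^sup>2 * u\<^sup>2 / 2)"
  proof eventually_elim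
    case (elim u)
    \<comment> \<open>Only degrees 1 and 2 have to be removed: the summand at \<open>n = 0\<close>
      is \<open>- 1 / 0 = 0\<close>.\<close>
    have "(\<lambda>n. if n \<in> {1,2} then - ((- (z * u)) ^ n) / of_nat n else 0) sums
        (\<Sum>n\<in>{1,2::nat}. - ((- (z * u)) ^ n) / of_nat n)"
      by (rule sums_If_finite_set) simp
    then have "(\<lambda>n. - ((- (z * u)) ^ n) / of_nat n -
         (if n \<in> {1,2} then - ((- (z * u)) ^ n) / of_nat n else 0)) sums
        (Ln (1 + z * u) - (\<Sum>n\<in>{1,2::nat}. - ((- (z * u)) ^ n) / of_nat n))"
      by (intro sums_diff Ln_series' elim)
    also have "(\<lambda>n. - ((- (z * u)) ^ n) / of_nat n -
         (if n \<in> {1,2} then - ((- (z * u)) ^ n) / of_nat n else 0)) = (\<lambda>n. log_fps z $ n * u ^ n)"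
    proof
      fix n :: nat
      consider "n = 0" | "n = 1" | "n = 2" | "n \<ge> 3" by linarith
      then show "- ((- (z * u)) ^ n) / of_nat n -
         (if n \<in> {1,2} then - ((- (z * u)) ^ n) / of_nat n else 0) = log_fps z $ n * u ^ n"
      proof cases
        case 4
        have "(- (z * u)) ^ n = (- z) ^ n * u ^ n" by (simp flip: power_mult_distrib)
        with 4 show ?thesis by (simp add: log_fps_def)
      qed (auto simp: log_fps_def)
    qed
    finally show ?case by (simp add: power_mult_distrib algebra_simps)
  qed
qed

text \<open>The four translates spell out \<open>T w - T (w + 1)\<close> with
  \<open>T w = S (w - \<tau>) - S w\<close>.\<close>

definition remainder_fps :: "nat \<Rightarrow> complex \<Rightarrow> complex \<Rightarrow> complex fps" where
  "remainder_fps M z \<tau> = log_fps z - (\<Sum>k=1..M. fps_const (tail_coeff z \<tau> k) *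
     (shift_fps (- \<tau>) k - shift_fps 0 k - shift_fps (1 - \<tau>) k + shift_fps 1 k))"

text \<open>The value at \<open>h = 0\<close> is prescribed because an expansion also fixes the
  value there, while \<open>1 / 0 = 0\<close> would give \<open>tail_remainder\<close> at the
  origin.\<close>

lemma has_fps_expansion_remainder_fps:
  "(\<lambda>h. if h = 0 then 0 else tail_remainder M z \<tau> (1 / h)) has_fps_expansion remainder_fps M z \<tau>"
proof -
  have "(\<lambda>h. (Ln (1 + z * h) - z * h + z ^ 2 * h ^ 2 / 2) -
      (\<Sum>k=1..M. tail_coeff z \<tau> k * ((h / (1 + (- \<tau>) * h)) ^ k - (h / (1 + 0 * h)) ^ k
         - (h / (1 + (1 - \<tau>) * h)) ^ k + (h / (1 + 1 * h)) ^ k))) has_fps_expansion remainder_fps M z \<tau>"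
    unfolding remainder_fps_def
    by (intro fps_expansion_intros has_fps_expansion_log_fps has_fps_expansion_shift_fps)
  moreover have "(Ln (1 + z * h) - z * h + z ^ 2 * h ^ 2 / 2) -
      (\<Sum>k=1..M. tail_coeff z \<tau> k * ((h / (1 + (- \<tau>) * h)) ^ k - (h / (1 + 0 * h)) ^ k
         - (h / (1 + (1 - \<tau>) * h)) ^ k + (h / (1 + 1 * h)) ^ k)) =
      (if h = 0 then 0 else tail_remainder M z \<tau> (1 / h))" for h
  proof (cases "h = 0")
    case True
    then show ?thesis by (auto intro!: sum.neutral simp: power_0_left)
  next
    case False
    \<comment> \<open>Division by zero makes both sides 0 when \<open>1 + a * h = 0\<close>, so this
      holds for all nonzero \<open>h\<close>.\<close>
    have "h / (1 + a * h) = 1 / (1 / h + a)" for a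
      using False by (simp add: divide_simps)
    then have shift: "(h / (1 + a * h)) ^ k = 1 / (1 / h + a) ^ k" for a k
      by (simp add: power_divide)
    have "(\<Sum>k=1..M. tail_coeff z \<tau> k * ((h / (1 + (- \<tau>) * h)) ^ k - (h / (1 + 0 * h)) ^ k
         - (h / (1 + (1 - \<tau>) * h)) ^ k + (h / (1 + 1 * h)) ^ k)) =
        tail_diff M z \<tau> (1 / h) - tail_diff M z \<tau> (1 / h + 1)"
      unfolding shift tail_diff_def tail_sum_def
      by (simp add: ring_distribs sum.distrib sum_subtractf add_diff_eq)
    moreover have "barnes_log z (1 / h) = Ln (1 + z * h) - z * h + z ^ 2 * h ^ 2 / 2"
      by (simp add: barnes_log_def power_divide)
    ultimately show ?thesis
      using False by (simp only: tail_remainder_def if_False)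
  qed
  ultimately show ?thesis by simp
qed

text \<open>On Borel transforms the double difference is multiplication by
  \<open>(exp (\<tau> * u) - 1) * (1 - exp (- u))\<close>. This factor has a double zero at 0, hence
  truncating the series after \<open>M\<close> terms affects only the coefficients from
  \<open>h ^ (M + 3)\<close> on.\<close>

lemma remainder_fps_nth_eq_0:
  assumes "\<tau> \<noteq> 0" and "j < M + 3"
  shows "remainder_fps M z \<tau> $ j = 0"
proof (cases j)
  \<comment> \<open>The Borel transform only sees positive powers of \<open>h\<close>, so the
    constant term is treated apart.\<close>
  case 0
  then show ?thesis
    by (auto simp: remainder_fps_def log_fps_def fps_sum_nth shift_fps_nth_0 intro!: sum.neutral)
next
  case (Suc i)
  define \<sigma> where "\<sigma> = tail_borel z \<tau>"
  define \<sigma>M where "\<sigma>M = Abs_fps (\<lambda>n. if n < M then tail_coeff z \<tau> (Suc n) / fact n else 0)"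
  define K where "K = (fps_exp \<tau> - 1) * (1 - fps_exp (-1) :: complex fps)"
  have K: "K = fps_exp \<tau> - fps_exp 0 - fps_exp (\<tau> - 1) + fps_exp (-1)"
    using fps_exp_add_mult[of \<tau> "-1"] by (simp add: K_def algebra_simps)
  have K0: "K $ l = 0" if "l < 2" for l
    using that by (cases l) (auto simp: K fps_exp_def less_Suc_eq)
  have i: "i < M + 2" using assms Suc by simp
  have "(\<Sum>k=1..M. tail_coeff z \<tau> k * (shift_fps (- \<tau>) k $ Suc i - shift_fps 0 k $ Suc i
           - shift_fps (1 - \<tau>) k $ Suc i + shift_fps 1 k $ Suc i)) =
      fact i * (fps_exp \<tau> * \<sigma>M) $ i - fact i * (fps_exp 0 * \<sigma>M) $ i
      - fact i * (fps_exp (\<tau> - 1) * \<sigma>M) $ i + fact i * (fps_exp (-1) * \<sigma>M) $ i"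
    using sum_shift_fps_nth_Suc[of "tail_coeff z \<tau>" "- \<tau>" i M]
      sum_shift_fps_nth_Suc[of "tail_coeff z \<tau>" 0 i M]
      sum_shift_fps_nth_Suc[of "tail_coeff z \<tau>" "1 - \<tau>" i M]
      sum_shift_fps_nth_Suc[of "tail_coeff z \<tau>" 1 i M]
    by (simp add: ring_distribs sum.distrib sum_subtractf flip: \<sigma>M_def)
  also have "\<dots> = fact i * (K * \<sigma>M) $ i"
    by (simp add: K ring_distribs)
  also have "(K * \<sigma>M) $ i = (K * \<sigma>) $ i"
  proof -
    have "K $ l * \<sigma>M $ (i - l) = K $ l * \<sigma> $ (i - l)" if "l \<le> i" for l
    proof (cases "l < 2")
      case False
      then have "i - l < M" using i that by linarith
      then show ?thesis by (simp add: \<sigma>_def \<sigma>M_def tail_borel_def)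
    qed (simp add: K0)
    then show ?thesis unfolding fps_mult_nth by (intro sum.cong) auto
  qed
  also have "(K * \<sigma>) $ i = (fps_X * (K * \<sigma>)) $ Suc i" by simp
  also have "fps_X * (K * \<sigma>) = - exp_tail3 z"
    unfolding K_def \<sigma>_def by (rule tail_borel_mult) fact
  \<comment> \<open>Undoing the Borel transform: \<open>fact i / fact (Suc i) = 1 / Suc i\<close>
    turns the exponential tail into the logarithmic one.\<close>
  also have "fact i * (- exp_tail3 z) $ Suc i = log_fps z $ Suc i"
    by (simp add: exp_tail3_def log_fps_def divide_simps del: of_nat_Suc) 
  finally show ?thesis
    by (simp add: Suc remainder_fps_def fps_sum_nth)
qed

section \<open>From vanishing coefficients to decay at infinity\<close>

text \<open>After division by \<open>h ^ n\<close> a power series remains, so the quotient is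
  continuous at 0 and bounded nearby. The zero series is treated apart because its subdegree is 0 by
  convention.\<close>

lemma has_fps_expansion_bound:
  fixes f :: "complex \<Rightarrow> complex"
  assumes "f has_fps_expansion F" and "\<And>j. j < n \<Longrightarrow> F $ j = 0"
  obtains C r where "r > 0" "\<And>h. cmod h < r \<Longrightarrow> h \<noteq> 0 \<Longrightarrow> cmod (f h) \<le> C * cmod h ^ n"
proof (cases "F = 0")
  case True
  then have "\<forall>\<^sub>F h in nhds 0. f h = 0"
    using assms(1) by (auto simp: has_fps_expansion_def elim: eventually_mono)
  then obtain r where "r > 0" "\<And>h. dist h 0 < r \<Longrightarrow> f h = 0"
    unfolding eventually_nhds_metric by blast
  then show ?thesis by (intro that[of r 0]) (auto simp: dist_norm)
next
  case False
  then have "n \<le> subdegree F" using assms(2) by (intro subdegree_geI) auto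
  define g where "g = (\<lambda>h. if h = 0 then F $ n else f h / h ^ n)"
  have "g has_fps_expansion fps_shift n F"
    unfolding g_def by (rule has_fps_expansion_shift) (use assms \<open>n \<le> subdegree F\<close> in auto)
  then have "isCont g 0" by (rule has_fps_expansion_imp_continuous)
  then obtain r where r: "r > 0" "\<And>h. dist h 0 < r \<Longrightarrow> dist (g h) (g 0) < 1"
    unfolding continuous_at_eps_delta by (metis zero_less_one)
  show ?thesis
  proof (rule that[OF r(1)])
    fix h assume h: "cmod h < r" "h \<noteq> 0"
    have "cmod (g h) \<le> cmod (g 0) + 1"
      using r(2)[of h] h norm_triangle_sub[of "g h" "g 0"] by (simp add: dist_norm)
    then show "cmod (f h) \<le> (cmod (g 0) + 1) * cmod h ^ n"
      using h by (simp add: g_def norm_divide norm_power divide_simps split: if_splits)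
  qed
qed

text \<open>Substitution \<open>h = 1 / w\<close>. Of the exponent \<open>M + 3\<close>, one power
  is lost in each of the two summations over the lattice, which leaves the \<open>M + 1\<close> of
  the error term.\<close>

lemma tail_remainder_bound:
  assumes "\<tau> \<noteq> 0"
  obtains C R where "R > 0" "C \<ge> 0"
    "\<And>w. cmod w > R \<Longrightarrow> cmod (tail_remainder M z \<tau> w) \<le> C / cmod w ^ (M + 3)"
proof -
  obtain C r where r: "r > 0" and
    C: "\<And>h. cmod h < r \<Longrightarrow> h \<noteq> 0 \<Longrightarrow> cmod (tail_remainder M z \<tau> (1 / h)) \<le> C * cmod h ^ (M + 3)"
    using has_fps_expansion_bound[OF has_fps_expansion_remainder_fps remainder_fps_nth_eq_0, OF assms]
    by (smt (verit, best))
  show ?thesis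
  proof (rule that[of "1 / r" "\<bar>C\<bar>"])
    fix w assume w: "cmod w > 1 / r"
    then have "w \<noteq> 0" using r by auto
    moreover have "cmod (1 / w) < r"
      using w r \<open>w \<noteq> 0\<close> by (simp add: norm_divide field_simps)
    ultimately have "cmod (tail_remainder M z \<tau> w) \<le> C / cmod w ^ (M + 3)"
      using C[of "1 / w"] by (simp add: norm_divide power_divide)
    also have "\<dots> \<le> \<bar>C\<bar> / cmod w ^ (M + 3)"
      by (intro divide_right_mono) auto
    finally show "cmod (tail_remainder M z \<tau> w) \<le> \<bar>C\<bar> / cmod w ^ (M + 3)" .
  qed (use r in auto)
qed

section \<open>Infinite products\<close>

text \<open>Bernoulli's inequality for \<open>(1 + 1 / (x - 1)) ^ p\<close>; this telescoping bound
  takes the place of an integral comparison.\<close>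

lemma inverse_power_le_diff:
  fixes x :: real
  assumes "x > 1" and "p \<ge> 1"
  shows "1 / x ^ Suc p \<le> 1 / (x - 1) ^ p - 1 / x ^ p"
proof -
  have "1 / x \<le> 1 / (x - 1)" using assms by (intro divide_left_mono) auto
  also have "\<dots> \<le> real p * (1 / (x - 1))"
    using assms mult_right_mono[of 1 "real p" "1 / (x - 1)"] by simp
  finally have "1 + 1 / x \<le> 1 + real p * (1 / (x - 1))" by simp
  also have "\<dots> \<le> (1 + 1 / (x - 1)) ^ p"
    using assms by (intro Bernoulli_inequality) (auto intro: order_trans[of _ 0])
  also have "1 + 1 / (x - 1) = x / (x - 1)"
    using assms by (simp add: field_simps)
  finally have "1 / x \<le> x ^ p / (x - 1) ^ p - 1"
    by (simp add: power_divide)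
  then have "1 / x * (1 / x ^ p) \<le> (x ^ p / (x - 1) ^ p - 1) * (1 / x ^ p)"
    using assms by (intro mult_right_mono) auto
  then show ?thesis using assms by (simp add: algebra_simps)
qed

text \<open>Used for the sum along a row of the lattice and again for the sum of the row
  totals.\<close>

lemma inverse_power_tail_bound:
  fixes a :: "nat \<Rightarrow> 'a::banach" and C :: real
  assumes "m \<ge> 2" "p \<ge> 1" "C \<ge> 0" and a: "\<And>n. norm (a n) \<le> C / real (m + n) ^ Suc p"
  shows "summable a" "norm (suminf a) \<le> C / (real m - 1) ^ p"
proof -
  define f where "f = (\<lambda>n. C / (real (m + n) - 1) ^ p)"
  have "filterlim (\<lambda>n. real (m + n) - 1) at_top sequentially" by real_asymp
  then have "filterlim (\<lambda>n. (real (m + n) - 1) ^ p) at_infinity sequentially"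
    using assms by (intro filterlim_at_top_imp_at_infinity filterlim_pow_at_top) simp_all
  then have "f \<longlonglongrightarrow> 0"
    unfolding f_def by (intro tendsto_divide_0[OF tendsto_const])
  then have sums: "(\<lambda>n. f n - f (Suc n)) sums f 0"
    using telescope_sums' by fastforce
  have le: "norm (a n) \<le> f n - f (Suc n)" for n
  proof -
    have "C * (1 / real (m + n) ^ Suc p) \<le> C * (1 / (real (m + n) - 1) ^ p - 1 / real (m + n) ^ p)"
      using assms by (intro mult_left_mono inverse_power_le_diff) auto
    with a[of n] show ?thesis by (simp add: f_def algebra_simps)
  qed
  have sn: "summable (\<lambda>n. norm (a n))"
    by (rule summable_comparison_test'[OF sums_summable[OF sums], of 0]) (use le in auto)
  then show "summable a" by (rule summable_norm_cancel)
  have "norm (suminf a) \<le> (\<Sum>n. norm (a n))" by (rule summable_norm[OF sn])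
  also have "\<dots> \<le> f 0"
    using suminf_le[OF le sn sums_summable[OF sums]] sums_unique[OF sums] by simp
  finally show "norm (suminf a) \<le> C / (real m - 1) ^ p" by (simp add: f_def)
qed

text \<open>The first \<open>K\<close> factors stay outside the exponential because
  \<open>1 + z / w\<close> may vanish for small \<open>w\<close>. The nonzero limit that
  \<open>convergent_prod\<close> demands from some index on is \<open>exp s\<close>.\<close>

lemma prodinf_exp_tail:
  fixes f :: "nat \<Rightarrow> complex"
  assumes f: "\<And>i. f (i + K) = exp (h i)" and h: "h sums s"
  shows "convergent_prod f" "prodinf f = (\<Prod>i<K. f i) * exp s"
proof -
  have lim: "(\<lambda>n. \<Prod>i\<le>n. f (i + K)) \<longlonglongrightarrow> exp s"
    using h unfolding sums_def_le by (auto simp: f exp_sum[symmetric] intro!: tendsto_exp)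
  then show conv: "convergent_prod f"
    unfolding convergent_prod_def raw_has_prod_def using exp_not_eq_zero by blast
  have "(\<Prod>i\<le>n + K. f i) = (\<Prod>i<K. f i) * (\<Prod>i\<le>n. f (i + K))" for n
  proof -
    have "(\<Prod>i\<le>n + K. f i) = (\<Prod>i\<in>{..<K} \<union> {K..n+K}. f i)"
      by (rule arg_cong2[of _ _ _ _ prod]) auto
    also have "\<dots> = (\<Prod>i<K. f i) * (\<Prod>i\<in>{K..n+K}. f i)"
      by (rule prod.union_disjoint) auto
    also have "(\<Prod>i\<in>{K..n+K}. f i) = (\<Prod>i\<le>n. f (i + K))"
      by (rule prod.reindex_bij_witness[of _ "\<lambda>i. i + K" "\<lambda>i. i - K"]) auto
    finally show ?thesis .
  qed
  then have "(\<lambda>n. \<Prod>i\<le>n + K. f i) \<longlonglongrightarrow> (\<Prod>i<K. f i) * exp s"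
    using lim by (auto intro!: tendsto_intros)
  moreover have "(\<lambda>n. \<Prod>i\<le>n + K. f i) \<longlonglongrightarrow> prodinf f"
    using LIMSEQ_ignore_initial_segment[OF convergent_prod_LIMSEQ[OF conv]] .
  ultimately show "prodinf f = (\<Prod>i<K. f i) * exp s"
    using LIMSEQ_unique by blast
qed

section \<open>Weierstrass products along a row and the Gamma function\<close>

definition barnes_factor :: "complex \<Rightarrow> complex \<Rightarrow> complex" where
  "barnes_factor z w = (1 + z / w) * exp (- (z / w) + z ^ 2 / (2 * w ^ 2))"

lemma exp_barnes_log:
  assumes "cmod z < cmod w"
  shows "exp (barnes_log z w) = barnes_factor z w"
proof -
  have "1 + z / w \<noteq> 0"
  proof
    assume "1 + z / w = 0"
    then have "z / w = -1" by (simp add: add_eq_0_iff)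
    then have "cmod (z / w) = 1" by simp
    with assms show False by (simp add: norm_divide divide_simps split: if_splits)
  qed
  then show ?thesis
    by (simp add: barnes_log_def barnes_factor_def exp_add exp_diff exp_minus field_simps)
qed

definition Gamma_factor :: "complex \<Rightarrow> complex \<Rightarrow> complex" where
  "Gamma_factor z w = Gamma w * rGamma (z + w) * exp (z * Digamma w + z ^ 2 / 2 * Polygamma 1 w)"

text \<open>Euler's limit at \<open>w\<close> and \<open>z + w\<close>: the quotient of Pochhammer
  symbols is the product of the \<open>1 + z / (w + n)\<close>, and the partial sums for
  \<open>Digamma\<close> and \<open>Polygamma 1\<close> give the exponents.\<close>

lemma barnes_factor_prod_LIMSEQ:
  assumes w: "w \<notin> \<int>\<^sub>\<le>\<^sub>0"
  shows "(\<lambda>k. \<Prod>n\<le>k. barnes_factor z (w + of_nat n)) \<longlonglongrightarrow> Gamma_factor z w"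
proof -
  have w0: "w \<noteq> 0" using w by auto
  have wn: "w + of_nat n \<noteq> 0" for n
  proof
    assume "w + of_nat n = 0"
    then have "w = - of_nat n" by (simp add: add_eq_0_iff2)
    then show False using w by simp
  qed
  have poly: "(\<lambda>k. \<Sum>n\<le>k. inverse ((w + of_nat n) ^ 2)) \<longlonglongrightarrow> Polygamma 1 w"
    using Polygamma_LIMSEQ[OF w0, of 1] by (simp add: sums_def_le numeral_2_eq_2)
  \<comment> \<open>\<open>Digamma_LIMSEQ\<close> sums over \<open>n < k\<close>, but the product
    includes \<open>n = k\<close>; the extra term tends to 0.\<close>
  have "(\<lambda>k. of_real (ln (real k)) - (\<Sum>n<k. inverse (w + of_nat n)) - inverse (w + of_nat k))
      \<longlonglongrightarrow> Digamma w - 0"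
    by (intro tendsto_diff Digamma_LIMSEQ w0 filterlim_compose[OF tendsto_inverse_0]
        tendsto_add_filterlim_at_infinity[OF tendsto_const] tendsto_of_nat)
  then have dig: "(\<lambda>k. of_real (ln (real k)) - (\<Sum>n\<le>k. inverse (w + of_nat n))) \<longlonglongrightarrow> Digamma w"
    by (simp add: lessThan_Suc_atMost[symmetric] algebra_simps)
  have "(\<lambda>k. Gamma_series w k * rGamma_series (z + w) k *
      exp (z * (of_real (ln (real k)) - (\<Sum>n\<le>k. inverse (w + of_nat n))) +
           z ^ 2 / 2 * (\<Sum>n\<le>k. inverse ((w + of_nat n) ^ 2)))) \<longlonglongrightarrow> Gamma_factor z w"
    unfolding Gamma_factor_def by (intro tendsto_intros dig poly)
  moreover have "Gamma_series w k * rGamma_series (z + w) k *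
      exp (z * (of_real (ln (real k)) - (\<Sum>n\<le>k. inverse (w + of_nat n))) +
           z ^ 2 / 2 * (\<Sum>n\<le>k. inverse ((w + of_nat n) ^ 2))) =
      (\<Prod>n\<le>k. barnes_factor z (w + of_nat n))" for k
  proof -
    define l :: complex where "l = of_real (ln (real k))"
    define P where "P = (\<Sum>n\<le>k. inverse (w + of_nat n))"
    define Q where "Q = (\<Sum>n\<le>k. inverse ((w + of_nat n) ^ 2))"
    have "exp ((z + w) * l) = exp (z * l) * exp (w * l)"
      by (simp only: distrib_right exp_add)
    then have "Gamma_series w k * rGamma_series (z + w) k =
        inverse (exp (z * l)) * (pochhammer (z + w) (Suc k) / pochhammer w (Suc k))"
      unfolding Gamma_series_def rGamma_series_def l_def[symmetric]
      by (simp add: divide_inverse mult_ac)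
    also have "pochhammer (z + w) (Suc k) / pochhammer w (Suc k) = (\<Prod>n\<le>k. 1 + z / (w + of_nat n))"
      unfolding pochhammer_prod atLeast0LessThan lessThan_Suc_atMost prod_dividef[symmetric]
      using wn by (intro prod.cong) (auto simp: divide_simps add_ac)
    finally have "Gamma_series w k * rGamma_series (z + w) k *
        exp (z * (l - P) + z ^ 2 / 2 * Q) =
        (\<Prod>n\<le>k. 1 + z / (w + of_nat n)) * (exp (- (z * l)) * exp (z * (l - P) + z ^ 2 / 2 * Q))"
      by (simp only: exp_minus mult_ac)
    \<comment> \<open>The factor left by the Gamma quotient cancels the logarithm from the
      \<open>Digamma\<close> limit, so the identity is exact for each \<open>k\<close>.\<close>
    also have "exp (- (z * l)) * exp (z * (l - P) + z ^ 2 / 2 * Q) = exp (- z * P + z ^ 2 / 2 * Q)"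
      unfolding exp_add[symmetric] by (rule arg_cong[of _ _ exp]) (simp add: algebra_simps)
    also have "\<dots> = (\<Prod>n\<le>k. exp (- (z / (w + of_nat n)) + z ^ 2 / (2 * (w + of_nat n) ^ 2)))"
    proof -
      have "- z * P + z ^ 2 / 2 * Q =
          (\<Sum>n\<le>k. - z * inverse (w + of_nat n) + z ^ 2 / 2 * inverse ((w + of_nat n) ^ 2))"
        unfolding P_def Q_def sum.distrib sum_distrib_left ..
      also have "\<dots> = (\<Sum>n\<le>k. - (z / (w + of_nat n)) + z ^ 2 / (2 * (w + of_nat n) ^ 2))"
        by (simp only: divide_inverse inverse_mult_distrib mult_minus_left mult_ac)
      finally show ?thesis by (simp only: exp_sum finite_atMost)
    qed
    finally show ?thesis
      unfolding barnes_factor_def prod.distrib l_def P_def Q_def .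
  qed
  ultimately show ?thesis by simp
qed

section \<open>Lattice estimates and telescoping\<close>

text \<open>The segment from 1 to \<open>\<tau>\<close> avoids 0, hence by compactness has a
  positive distance from it; for \<open>m + n > 0\<close> the lattice point is \<open>m + n\<close>
  times a point of the segment.\<close>

lemma lattice_norm_bound:
  assumes "\<tau> \<notin> \<real>\<^sub>\<le>\<^sub>0"
  obtains c where "c > 0" "\<And>m n :: nat. cmod (of_nat m * \<tau> + of_nat n) \<ge> c * real (m + n)"
proof -
  define f where "f = (\<lambda>s::real. cmod (of_real s * \<tau> + of_real (1 - s)))"
  have "continuous_on {0..1} f" unfolding f_def by (intro continuous_intros)
  then obtain s where s: "s \<in> {0..1}" "\<And>t. t \<in> {0..1} \<Longrightarrow> f s \<le> f t"
    using continuous_attains_inf[of "{0..1::real}" f] by auto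
  have "f s \<noteq> 0"
  proof
    assume "f s = 0"
    then have eq: "of_real s * \<tau> = of_real (s - 1)" by (simp add: f_def algebra_simps add_eq_0_iff)
    then have "s \<noteq> 0" by auto
    then have "\<tau> = of_real ((s - 1) / s)" using eq by (simp add: field_simps)
    moreover have "(s - 1) / s \<le> 0" using s by (simp add: divide_nonpos_nonneg)
    ultimately show False using assms nonpos_Reals_of_real_iff by metis
  qed
  then have "f s > 0" by (simp add: f_def)
  moreover have "cmod (of_nat m * \<tau> + of_nat n) \<ge> f s * real (m + n)" for m n :: nat
  proof (cases "m + n = 0")
    case False
    define t where "t = real m / real (m + n)"
    have t: "t \<in> {0..1}" "t * real (m + n) = real m" "(1 - t) * real (m + n) = real n"
      using False by (auto simp: t_def left_diff_distrib divide_simps)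
    have "of_nat m * \<tau> + of_nat n = of_real (real m) * \<tau> + of_real (real n)" by simp
    also have "\<dots> = (of_real t * \<tau> + of_real (1 - t)) * of_real (real (m + n))"
      unfolding t(2,3)[symmetric] of_real_mult by (simp add: algebra_simps)
    finally have "cmod (of_nat m * \<tau> + of_nat n) = f t * real (m + n)"
      by (simp add: f_def norm_mult del: of_nat_add)
    with s(2)[OF t(1)] show ?thesis by (simp add: mult_right_mono del: of_nat_add)
  qed simp
  ultimately show ?thesis by (rule that)
qed

lemma tail_sum_tendsto_0:
  assumes "filterlim x at_infinity F"
  shows "((\<lambda>i. tail_sum M z \<tau> (x i)) \<longlongrightarrow> 0) F"
proof -
  have "((\<lambda>i. \<Sum>k=1..M. tail_coeff z \<tau> k / x i ^ k) \<longlongrightarrow> (\<Sum>k=1..M. 0)) F"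
    by (intro tendsto_sum tendsto_divide_0[OF tendsto_const]
      Limits.filterlim_power_at_infinity assms) auto
  then show ?thesis by (simp add: tail_sum_def)
qed

lemma filterlim_add_of_nat_at_infinity:
  "filterlim (\<lambda>i. w + of_nat i :: complex) at_infinity sequentially"
  by (intro tendsto_add_filterlim_at_infinity[OF tendsto_const] tendsto_of_nat)

text \<open>Inner telescoping: \<open>T w - T (w + 1)\<close> sums along the row to
  \<open>T w\<close>, since \<open>T\<close> tends to 0.\<close>

lemma barnes_log_sums:
  assumes "summable (\<lambda>i. tail_remainder M z \<tau> (w + of_nat i))"
  shows "(\<lambda>i. barnes_log z (w + of_nat i)) sums
           ((\<Sum>i. tail_remainder M z \<tau> (w + of_nat i)) + tail_diff M z \<tau> w)"
proof -
  have "(\<lambda>i. tail_diff M z \<tau> (w + of_nat i)) \<longlonglongrightarrow> 0 - 0"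
    unfolding tail_diff_def
    using filterlim_add_of_nat_at_infinity[of w] filterlim_add_of_nat_at_infinity[of "w - \<tau>"]
    by (intro tendsto_diff tail_sum_tendsto_0) (auto simp: algebra_simps)
  from sums_add[OF summable_sums[OF assms] telescope_sums'[OF this]] show ?thesis
    by (simp add: tail_remainder_def algebra_simps)
qed

lemma powi_minus_Suc: "(x :: 'a :: field) powi (- int k - 1) = inverse (x ^ Suc k)"
proof -
  have "- int k - 1 = - int (Suc k)" by simp
  then show ?thesis by (simp only: power_int_minus power_int_of_nat)
qed

lemma of_nat_mult_notin_nonpos_Ints:
  fixes \<tau> :: complex
  assumes "\<tau> \<notin> \<real>\<^sub>\<le>\<^sub>0" and "m > 0"
  shows "of_nat m * \<tau> \<notin> \<int>\<^sub>\<le>\<^sub>0"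
proof
  assume "of_nat m * \<tau> \<in> \<int>\<^sub>\<le>\<^sub>0"
  then obtain n where n: "of_nat m * \<tau> = - of_nat n" by (elim nonpos_Ints_cases')
  then have "\<tau> = of_real (- (real n / real m))"
    using assms(2) by (simp add: field_simps)
  moreover have "- (real n / real m) \<le> 0" by simp
  ultimately show False using assms(1) nonpos_Reals_of_real_iff by metis
qed

text \<open>Row \<open>m = 0\<close> omits the origin and so starts at \<open>w = 1\<close>. Its
  exponential accounts for the passage from \<open>barnes_a\<close>, \<open>barnes_b\<close> to
  their tilde versions.\<close>

lemma Gamma_factor_1:
  "Gamma_factor z 1 = rGamma (z + 1) * exp (- euler_mascheroni * z + of_real pi ^ 2 * z ^ 2 / 12)"
proof -
  have "(\<lambda>k. of_real (1 / (real k + 1) ^ 2)) sums (of_real (pi ^ 2 / 6) :: complex)"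
    using inverse_squares_sums by (intro sums_of_real) (simp add: add_ac)
  moreover have "(\<lambda>k. of_real (1 / (real k + 1) ^ 2)) sums (Polygamma 1 1 :: complex)"
    using Polygamma_LIMSEQ[of "1::complex" 1]
    by (simp add: numeral_2_eq_2 divide_inverse add_ac)
  ultimately have "Polygamma 1 (1::complex) = of_real (pi ^ 2 / 6)"
    using sums_unique2 by blast
  then have "z * Digamma 1 + z ^ 2 / 2 * Polygamma 1 1 =
      - euler_mascheroni * z + of_real pi ^ 2 * z ^ 2 / 12"
    by (simp only: Digamma_1) simp
  then show ?thesis
    by (simp only: Gamma_factor_def) simp
qed

theorem theorem1:
  fixes z \<tau> :: complex and M :: nat
  assumes "\<tau> \<noteq> 0" and "\<bar>Arg \<tau>\<bar> < pi" and "M \<ge> 1"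
  shows "\<exists>E :: nat \<Rightarrow> complex.
           E \<in> O(\<lambda>N. of_nat N powi (- int M - 1)) \<and>
           (\<forall>\<^sub>F N in sequentially.
              double_Gamma z \<tau> =
                double_Gamma_approx N z \<tau> *
                exp (z ^ 3 * (\<Sum>k=1..M. (- \<tau>) powi (- int k - 1) * barnes_P k z (- \<tau>)
                                / (of_nat k * (of_nat k + 1) * (of_nat k + 2))
                                * of_nat N powi (- int k))
                     + E N))"
proof -
  \<comment> \<open>The bound on the argument excludes only the negative reals, as
    \<open>Arg 0 = 0\<close>; the origin is excluded by the first assumption.\<close>
  have \<tau>: "\<tau> \<notin> \<real>\<^sub>\<le>\<^sub>0"
    using assms(1,2) Arg_eq_pi[of \<tau>] by (auto simp: complex_nonpos_Reals_iff complex_eq_iff)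
  obtain c where c: "c > 0" "\<And>m n :: nat. cmod (of_nat m * \<tau> + of_nat n) \<ge> c * real (m + n)"
    using lattice_norm_bound[OF \<tau>] by blast
  obtain C R where R: "R > 0" and C: "C \<ge> 0"
    "\<And>w. cmod w > R \<Longrightarrow> cmod (tail_remainder M z \<tau> w) \<le> C / cmod w ^ (M + 3)"
    using tail_remainder_bound[OF assms(1)] by metis
  \<comment> \<open>Lattice points with \<open>m + n \<ge> L\<close> exceed \<open>R\<close>, where
    the remainder bound applies, and \<open>cmod z\<close>, where \<open>exp_barnes_log\<close>
    applies; \<open>L \<ge> 2\<close> serves the tail estimates.\<close>
  obtain L :: nat where L: "real L > max R (cmod z) / c" "L \<ge> 2"
  proof -
    obtain L0 :: nat where "real L0 > max R (cmod z) / c" using reals_Archimedean2 by blast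
    then show ?thesis by (intro that[of "max L0 2"]) auto
  qed
  define C' where "C' = C / c ^ (M + 3)"
  have C': "C' \<ge> 0" using C c by (simp add: C'_def)
  \<comment> \<open>\<open>D m\<close> collects the remainders of row \<open>m\<close>;
    \<open>E N\<close>, the sum over the rows beyond \<open>N\<close>, is the witness for the error
    term.\<close>
  define D where "D = (\<lambda>m. \<Sum>i. tail_remainder M z \<tau> (of_nat m * \<tau> + of_nat i))"
  define f where "f = (\<lambda>m n. if m = 0 \<and> n = 0 then 1
        else barnes_factor z (of_nat m * \<tau> + of_nat n))"
  define E where "E = (\<lambda>N. \<Sum>i. D (i + Suc N))"

  have large: "cmod (of_nat m * \<tau> + of_nat n) > max R (cmod z)" if "L \<le> m + n" for m n
  proof -
    have "max R (cmod z) < c * real L" using L c by (simp add: field_simps)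
    also have "\<dots> \<le> c * real (m + n)" using that c by (intro mult_left_mono) auto
    finally show ?thesis using c(2)[of m n] by linarith
  qed
  have rem: "cmod (tail_remainder M z \<tau> (of_nat m * \<tau> + of_nat n)) \<le> C' / real (m + n) ^ Suc (M + 2)"
    if "L \<le> m + n" for m n
  proof -
    have "cmod (tail_remainder M z \<tau> (of_nat m * \<tau> + of_nat n)) \<le>
        C / cmod (of_nat m * \<tau> + of_nat n) ^ (M + 3)"
      using large[OF that] by (intro C(2)) simp
    also have "\<dots> \<le> C / (c * real (m + n)) ^ (M + 3)"
      using that L c C(1) by (intro divide_left_mono power_mono mult_pos_pos zero_less_power
          order.strict_trans2[OF _ c(2)]) auto
    also have "\<dots> = C' / real (m + n) ^ Suc (M + 2)"
      by (simp add: C'_def power_mult_distrib eval_nat_numeral)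
    finally show ?thesis .
  qed
  have tail: "summable (\<lambda>i. tail_remainder M z \<tau> ((of_nat m * \<tau> + of_nat K) + of_nat i))"
    if "L \<le> m + K" for m K
    by (rule inverse_power_tail_bound(1)[of "m + K" "M + 2" C'])
       (use that L C' rem[of m "K + i" for i] in \<open>auto simp: add_ac\<close>)
  have log: "f m (i + K) = exp (barnes_log z ((of_nat m * \<tau> + of_nat K) + of_nat i))"
    if "L \<le> m + K" for m K i
    using exp_barnes_log[of z "(of_nat m * \<tau> + of_nat K) + of_nat i"] large[of m "K + i"] that L
    by (auto simp: f_def add_ac)
  have conv: "convergent_prod (f m)" for m
    by (rule prodinf_exp_tail(1)[OF log barnes_log_sums[OF tail], of m L]) simp_all

  have f0: "prodinf (f 0) = Gamma_factor z 1"
  proof -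
    have "(\<lambda>k. \<Prod>n\<le>Suc k. f 0 n) \<longlonglongrightarrow> prodinf (f 0)"
      using LIMSEQ_Suc[OF convergent_prod_LIMSEQ[OF conv[of 0]]] .
    moreover have "(\<Prod>n\<le>Suc k. f 0 n) = (\<Prod>n\<le>k. barnes_factor z (1 + of_nat n))" for k
      unfolding prod.atMost_Suc_shift by (simp add: f_def)
    moreover have "(\<lambda>k. \<Prod>n\<le>k. barnes_factor z (1 + of_nat n)) \<longlonglongrightarrow> Gamma_factor z 1"
      by (rule barnes_factor_prod_LIMSEQ) simp
    ultimately show ?thesis using LIMSEQ_unique by auto
  qed
  have fm: "prodinf (f m) = Gamma_factor z (of_nat m * \<tau>)" if "m > 0" for m
    using LIMSEQ_unique[OF convergent_prod_LIMSEQ[OF conv[of m]]]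
      barnes_factor_prod_LIMSEQ[OF of_nat_mult_notin_nonpos_Ints[OF \<tau> that], of z] that
    by (simp add: f_def)
  have fD: "prodinf (f m) = exp (D m + tail_diff M z \<tau> (of_nat m * \<tau>))" if "L \<le> m" for m
    using prodinf_exp_tail(2)[OF log barnes_log_sums[OF tail], of m 0] that
    by (simp add: D_def)
  have D: "cmod (D m) \<le> C' / (real m - 1) ^ (M + 2)" if "L \<le> m" for m
    unfolding D_def
    by (rule inverse_power_tail_bound(2)) (use that L C' rem in auto)
  \<comment> \<open>The shift by \<open>Suc N\<close> absorbs the \<open>- 1\<close> in the bound
    for \<open>D\<close>.\<close>
  have "cmod (D (i + Suc N)) \<le> C' / real (N + i) ^ Suc (M + 1)" if "L \<le> N" for N i
    using D[of "i + Suc N"] that by (simp add: add_ac)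
  then have E: "summable (\<lambda>i. D (i + Suc N))" "cmod (E N) \<le> C' / (real N - 1) ^ (M + 1)"
    if "L \<le> N" for N
    unfolding E_def using that L C' by (intro inverse_power_tail_bound[of N "M + 1" C']; simp)+

  have S0: "(\<lambda>i. tail_sum M z \<tau> (of_nat (i + N) * \<tau>)) \<longlonglongrightarrow> 0" for N
  proof -
    have "filterlim (\<lambda>i. \<tau> * (of_nat N + of_nat i)) at_infinity sequentially"
      by (rule tendsto_mult_filterlim_at_infinity[OF tendsto_const assms(1)
            filterlim_add_of_nat_at_infinity])
    then show ?thesis by (intro tail_sum_tendsto_0) (simp add: mult_ac add_ac)
  qed
  have outer: "prodinf (\<lambda>m. prodinf (f m)) =
      (\<Prod>m<Suc N. prodinf (f m)) * exp (E N + tail_sum M z \<tau> (of_nat N * \<tau>))" if "L \<le> N" for N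
  proof (rule prodinf_exp_tail(2))
    show "prodinf (f (i + Suc N)) = exp (D (i + Suc N) + tail_diff M z \<tau> (of_nat (i + Suc N) * \<tau>))" for i
      using that by (intro fD) simp
    \<comment> \<open>Outer telescoping:
      \<open>T (m * \<tau>) = S ((m - 1) * \<tau>) - S (m * \<tau>)\<close>, summed from
      \<open>m = N + 1\<close>.\<close>
    have "(\<lambda>i. tail_diff M z \<tau> (of_nat (i + Suc N) * \<tau>)) sums (tail_sum M z \<tau> (of_nat N * \<tau>))"
      using telescope_sums'[OF S0[of N]] by (simp add: tail_diff_def algebra_simps)
    then show "(\<lambda>i. D (i + Suc N) + tail_diff M z \<tau> (of_nat (i + Suc N) * \<tau>)) sums
        (E N + tail_sum M z \<tau> (of_nat N * \<tau>))"
      unfolding E_def using E(1)[OF that] by (intro sums_add summable_sums)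
  qed

  \<comment> \<open>The factor \<open>z\<close> is absorbed by
    \<open>z * rGamma (z + 1) = rGamma z\<close>, which also holds at the poles of
    \<open>Gamma\<close>.\<close>
  have pre: "z / \<tau> * exp (barnes_a \<tau> * (z / \<tau>) + barnes_b \<tau> * (z ^ 2 / (2 * \<tau> ^ 2))) * Gamma_factor z 1 =
      1 / \<tau> * rGamma z * exp (barnes_a_tilde \<tau> * (z / \<tau>) + barnes_b_tilde \<tau> * (z ^ 2 / (2 * \<tau> ^ 2)))"
  proof -
    have "barnes_a_tilde \<tau> * (z / \<tau>) + barnes_b_tilde \<tau> * (z ^ 2 / (2 * \<tau> ^ 2)) =
        (barnes_a \<tau> * (z / \<tau>) + barnes_b \<tau> * (z ^ 2 / (2 * \<tau> ^ 2))) +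
        (- euler_mascheroni * z + of_real pi ^ 2 * z ^ 2 / 12)"
      using assms(1) by (simp add: barnes_a_tilde_def barnes_b_tilde_def field_simps power2_eq_square)
    then show ?thesis
      unfolding Gamma_factor_1 by (simp only: exp_add) (simp add: rGamma_plus1[of z, symmetric])
  qed
  have main: "double_Gamma z \<tau> = double_Gamma_approx N z \<tau> * exp (tail_sum M z \<tau> (of_nat N * \<tau>) + E N)"
    if "L \<le> N" for N
  proof -
    have "(\<Prod>m<Suc N. prodinf (f m)) = Gamma_factor z 1 * (\<Prod>m=1..N. Gamma_factor z (of_nat m * \<tau>))"
      unfolding prod.lessThan_Suc_shift f0
      by (intro arg_cong2[of _ _ _ _ "(*)"] refl prod.reindex_bij_witness[of _ "\<lambda>k. k - 1" Suc])
         (auto simp: fm simp del: of_nat_Suc)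
    then have "double_Gamma z \<tau> =
        z / \<tau> * exp (barnes_a \<tau> * (z / \<tau>) + barnes_b \<tau> * (z ^ 2 / (2 * \<tau> ^ 2))) * Gamma_factor z 1 *
        (\<Prod>m=1..N. Gamma_factor z (of_nat m * \<tau>)) * exp (tail_sum M z \<tau> (of_nat N * \<tau>) + E N)"
      using outer[OF that]
      unfolding double_Gamma_def f_def barnes_factor_def
      by (simp only: mult.assoc add.commute[of "E N"])
    then show ?thesis
      by (simp only: pre) (simp only: double_Gamma_approx_def Gamma_factor_def)
  qed

  have sum_eq: "z ^ 3 * (\<Sum>k=1..M. (- \<tau>) powi (- int k - 1) * barnes_P k z (- \<tau>)
        / (of_nat k * (of_nat k + 1) * (of_nat k + 2)) * of_nat N powi (- int k)) =
      tail_sum M z \<tau> (of_nat N * \<tau>)" for N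
  proof -
    \<comment> \<open>Of the \<open>k + 1\<close> powers of \<open>\<tau>\<close>, \<open>k\<close>
      join those of \<open>N\<close>; the spare one is the \<open>\<tau>\<close> in the denominator
      of \<open>tail_coeff\<close>.\<close>
    have powi: "(- \<tau>) powi (- int k - 1) * of_nat N powi (- int k) =
        (-1) ^ (k + 1) / (\<tau> * (of_nat N * \<tau>) ^ k)" for k
    proof -
      have "of_nat N powi (- int k) = inverse (of_nat N ^ k :: complex)"
        by (simp only: power_int_minus power_int_of_nat)
      then have "(- \<tau>) powi (- int k - 1) * of_nat N powi (- int k) =
          inverse ((- \<tau>) ^ Suc k) * inverse (of_nat N ^ k)"
        by (simp only: powi_minus_Suc)
      moreover have "(- \<tau>) ^ Suc k = (-1) ^ (k + 1) * (\<tau> * \<tau> ^ k)"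
        by (simp add: power_minus[of \<tau> k])
      moreover have "inverse ((-1) ^ (k + 1)) = ((-1) ^ (k + 1) :: complex)"
        by (simp flip: power_inverse)
      ultimately show ?thesis
        by (simp only: power_mult_distrib divide_inverse inverse_mult_distrib mult_ac)
    qed
    have term_eq: "z ^ 3 * ((- \<tau>) powi (- int k - 1) * x / y * of_nat N powi (- int k)) =
        z ^ 3 * (-1) ^ (k + 1) * x / (\<tau> * y) / (of_nat N * \<tau>) ^ k" for k x y
    proof -
      have "z ^ 3 * ((- \<tau>) powi (- int k - 1) * x / y * of_nat N powi (- int k)) =
          z ^ 3 * x / y * ((- \<tau>) powi (- int k - 1) * of_nat N powi (- int k))"
        by (simp only: divide_inverse mult_ac)
      also have "\<dots> = z ^ 3 * (-1) ^ (k + 1) * x / (\<tau> * y) / (of_nat N * \<tau>) ^ k"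
        unfolding powi by (simp only: divide_inverse inverse_mult_distrib mult_ac)
      finally show ?thesis .
    qed
    show ?thesis
      unfolding tail_sum_def sum_distrib_left tail_coeff_def by (intro sum.cong refl term_eq)
  qed

  have "E \<in> O(\<lambda>N. of_nat N powi (- int M - 1))"
  proof (rule bigoI[of _ "C' * 2 ^ (M + 1)"], rule eventually_sequentiallyI[of L])
    fix N assume N: "L \<le> N"
    have "cmod (E N) \<le> C' / (real N - 1) ^ (M + 1)" using E(2)[OF N] .
    \<comment> \<open>\<open>N - 1 \<ge> N / 2\<close> because
      \<open>N \<ge> L \<ge> 2\<close>.\<close>
    also have "\<dots> \<le> C' / (real N / 2) ^ (M + 1)"
      using N L C' by (intro divide_left_mono power_mono mult_pos_pos zero_less_power) auto
    also have "\<dots> = C' * 2 ^ (M + 1) * norm ((of_nat N :: complex) powi (- int M - 1))"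
      unfolding powi_minus_Suc norm_inverse norm_power norm_of_nat power_divide Suc_eq_plus1
      by (simp add: inverse_eq_divide)
    finally show "cmod (E N) \<le> C' * 2 ^ (M + 1) * norm ((of_nat N :: complex) powi (- int M - 1))" .
  qed
  moreover have "\<forall>\<^sub>F N in sequentially. double_Gamma z \<tau> =
                double_Gamma_approx N z \<tau> *
                exp (z ^ 3 * (\<Sum>k=1..M. (- \<tau>) powi (- int k - 1) * barnes_P k z (- \<tau>)
                                / (of_nat k * (of_nat k + 1) * (of_nat k + 2))
                                * of_nat N powi (- int k))
                     + E N)"
    unfolding sum_eq using main by (rule eventually_sequentiallyI)
  ultimately show ?thesis by blast
qed

end
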